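(* Let $1\le q<2$ and $q<p\le\infty$, and let $$A=\begin{bmatrix}1&1&0\\1&-1&0\\0&1&1\\0&1&-1\\1&0&1\\1&0&-1\end{bmatrix}.$$ Then $\|A\|_{p,q}^{\mathbb{C}}>\|A\|_{p,q}^{\mathbb{R}}$.
   Context: For a real matrix $A\in\mathbb{R}^{m\times n}$, $p,q\in[1,\infty]$ and $\mathbb{F}=\mathbb{R}$ or $\mathbb{C}$, $$\|A\|_{p,q}^{\mathbb{F}}=\sup_{x\in\mathbb{F}^n\setminus\{0\}}\frac{\|Ax\|_q}{\|x\|_p},$$ where $\|x\|_p=\left(\sum_t|x_t|^p\right)^{1/p}$ for $p<\infty$ and $\|x\|_\infty=\max_t|x_t|$. *)

theory Defs
  imports "HOL-Analysis.Analysis"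
begin

(* Meant for 1 \<le> p \<le> \<infinity>. For p = \<infinity> this is not infnorm, which on complex
   vectors is the maximum over the real and imaginary parts of the entries. *)
definition lp_norm :: "ereal \<Rightarrow> 'a::real_normed_vector ^ 'n \<Rightarrow> real" where
  "lp_norm p x =
     (if p = \<infinity> then Max (range (\<lambda>t. norm (x $ t)))
      else (\<Sum>t\<in>UNIV. norm (x $ t) powr real_of_ereal p) powr (1 / real_of_ereal p))"

(* The scalar field F is passed as a type token, TYPE(real) or TYPE(complex). The
   supremum is taken in ereal, so it exists without a boundedness proof. *)
definition pq_norm :: "'f::real_normed_field itself \<Rightarrow> ereal \<Rightarrow> ereal \<Rightarrow> real ^ 'n ^ 'm \<Rightarrow> ereal" where
  "pq_norm F p q A =
     (SUP x \<in> UNIV - {0 :: 'f ^ 'n}.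
        ereal (lp_norm q (map_matrix of_real A *v x) / lp_norm p x))"

(* vector indexes its list by 1, 2, ...; in the index type 6 the numeral 6 is 0. *)
lemma vector_6:
  "(vector [a,b,c,d,e,f] :: ('a::zero)^6) $ 1 = a"
  "(vector [a,b,c,d,e,f] :: ('a::zero)^6) $ 2 = b"
  "(vector [a,b,c,d,e,f] :: ('a::zero)^6) $ 3 = c"
  "(vector [a,b,c,d,e,f] :: ('a::zero)^6) $ 4 = d"
  "(vector [a,b,c,d,e,f] :: ('a::zero)^6) $ 5 = e"
  "(vector [a,b,c,d,e,f] :: ('a::zero)^6) $ 6 = f"
  unfolding vector_def by simp_all

end

theory Submission
  imports Defs
begin

text \<open>
  The rows of the matrix send \<open>x\<close> to the sums and differences of its pairs of entries, so the
  \<open>q\<close>-th power of the numerator of the quotient is the sum over the three pairs of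
  \<open>\<bar>a + b\<bar>\<^sup>q + \<bar>a - b\<bar>\<^sup>q\<close>.

  Changing the arguments of the entries of a vector leaves its \<open>p\<close>-norm alone. It also leaves
  \<open>\<bar>a + b\<bar>\<^sup>2 + \<bar>a - b\<bar>\<^sup>2\<close> alone, by the parallelogram law, but it brings the two squares
  closer together when \<open>a\<close> and \<open>b\<close> stop being real multiples of each other. As \<open>q < 2\<close>, the
  function \<open>t powr (q / 2)\<close> is strictly concave, so
  \<open>\<bar>a + b\<bar>\<^sup>q + \<bar>a - b\<bar>\<^sup>q\<close> then increases strictly unless \<open>a\<close> or \<open>b\<close> vanishes
  (\<open>pair_sum_phase_less\<close>). Over the complex numbers three pairwise non-parallel directions
  exist, whereas over the reals there is only one, up to sign. Hence every real vector with at
  least two nonzero entries has a strictly larger complex competitor.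

  Over the reals the supremum is attained, by homogeneity and compactness of the sphere
  (\<open>real_pq_norm_attained\<close>), so a single competitor gives the strict inequality. What is left is to
  see that no maximiser has just one nonzero entry. Replacing a zero entry of
  a coordinate vector by a small \<open>e > 0\<close> adds at least \<open>2 * e powr q\<close> to the \<open>q\<close>-th power of
  the numerator, but only a term of order \<open>e powr p\<close> to that of the denominator, and nothing
  if \<open>p = \<infinity>\<close>; as \<open>q < p\<close>, the
  quotient grows (\<open>two_entries_beat_one\<close>).
\<close>

section \<open>The lp norm\<close>

lemma lp_norm_ereal:
  "lp_norm (ereal r) x = (\<Sum>t\<in>UNIV. norm (x $ t) powr r) powr (1 / r)"
  by (simp add: lp_norm_def)

lemma lp_norm_pos:
  fixes x :: "'a::real_normed_vector ^ 'n"
  assumes "x \<noteq> 0"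
  shows "lp_norm p x > 0"
proof -
  obtain k where k: "norm (x $ k) > 0"
    using assms by (metis vec_eq_iff zero_index zero_less_norm_iff)
  show ?thesis
  proof (cases "p = \<infinity>")
    case True
    have "norm (x $ k) \<le> Max (range (\<lambda>t. norm (x $ t)))"
      by (rule Max_ge) auto
    with k have "0 < Max (range (\<lambda>t. norm (x $ t)))"
      by (rule less_le_trans)
    with True show ?thesis
      by (simp add: lp_norm_def)
  next
    case False
    have "(\<Sum>t\<in>UNIV. norm (x $ t) powr real_of_ereal p) > 0"
      using k by (intro sum_pos2[where i = k]) auto
    with False show ?thesis
      by (simp add: lp_norm_def)
  qed
qed

lemma lp_norm_scaleR:
  fixes x :: "'a::real_normed_vector ^ 'n"
  assumes "p > 0"
  shows "lp_norm p (c *\<^sub>R x) = \<bar>c\<bar> * lp_norm p x"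
proof (cases p)
  case (real r)
  with assms have r: "r > 0"
    by simp
  have "(\<Sum>t\<in>UNIV. norm ((c *\<^sub>R x) $ t) powr r)
      = \<bar>c\<bar> powr r * (\<Sum>t\<in>UNIV. norm (x $ t) powr r)"
    by (simp add: powr_mult sum_distrib_left)
  with r real show ?thesis
    by (simp add: lp_norm_ereal powr_mult powr_powr sum_nonneg)
next
  case PInf
  have "mono (\<lambda>y. \<bar>c\<bar> * y)"
    by (intro monoI mult_left_mono) auto
  from mono_Max_commute[OF this, of "range (\<lambda>t. norm (x $ t))"]
  show ?thesis
    using PInf by (simp add: lp_norm_def image_image)
next
  case MInf
  with assms show ?thesis by simp
qed

lemma continuous_on_Max:
  fixes f :: "'i \<Rightarrow> 'a::topological_space \<Rightarrow> real"
  assumes "finite I" "I \<noteq> {}" "\<And>i. i \<in> I \<Longrightarrow> continuous_on S (f i)"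
  shows "continuous_on S (\<lambda>x. Max ((\<lambda>i. f i x) ` I))"
  using assms
proof (induction I rule: finite_ne_induct)
  case (insert i I)
  then show ?case
    by (simp add: continuous_on_max)
qed simp

lemma continuous_on_lp_norm:
  assumes "p > 0"
  shows "continuous_on S (lp_norm p :: 'a::real_normed_vector ^ 'n \<Rightarrow> real)"
proof (cases p)
  case (real r)
  with assms have "r > 0"
    by simp
  then have "continuous_on S (\<lambda>x::'a ^ 'n. (\<Sum>t\<in>UNIV. norm (x $ t) powr r) powr (1 / r))"
    by (intro continuous_intros continuous_on_powr') (auto intro: sum_nonneg)
  with real show ?thesis
    by (simp add: lp_norm_ereal)
next
  case PInf
  have "continuous_on S (\<lambda>x::'a ^ 'n. Max (range (\<lambda>t. norm (x $ t))))"
    by (intro continuous_on_Max continuous_intros) auto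
  with PInf show ?thesis
    by (simp add: lp_norm_def)
next
  case MInf
  with assms show ?thesis by simp
qed

section \<open>The norm of a real matrix over the reals is attained\<close>

lemma map_matrix_of_real_id: "map_matrix of_real A = (A :: real ^ 'n ^ 'm)"
  by (simp add: map_matrix_def vec_eq_iff)

text \<open>
  The quotient does not change under scaling, so its supremum is a maximum over the unit sphere,
  where it is continuous.
\<close>
lemma real_pq_norm_attained:
  fixes A :: "real ^ 'n ^ 'm"
  assumes "p > 0" "q > 0"
  obtains x :: "real ^ 'n" where "x \<noteq> 0"
    and "pq_norm TYPE(real) p q A = ereal (lp_norm q (A *v x) / lp_norm p x)"
    and "\<And>y. y \<noteq> 0 \<Longrightarrow> lp_norm q (A *v y) / lp_norm p y \<le> lp_norm q (A *v x) / lp_norm p x"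
proof -
  define R where "R = (\<lambda>x. lp_norm q (A *v x) / lp_norm p x)"
  have "continuous_on (sphere 0 1) (\<lambda>x. lp_norm q (A *v x))"
    by (rule continuous_on_compose2[OF continuous_on_lp_norm[OF \<open>q > 0\<close>, of UNIV]])
      (auto intro: matrix_vector_mult_linear_continuous_on)
  moreover have "lp_norm p x \<noteq> 0" if "x \<in> sphere 0 1" for x :: "real ^ 'n"
  proof -
    have "x \<noteq> 0"
      using that by auto
    then show ?thesis
      by (metis lp_norm_pos less_irrefl)
  qed
  ultimately have "continuous_on (sphere 0 1) R"
    unfolding R_def by (intro continuous_on_divide continuous_on_lp_norm assms ballI)
  moreover have "compact (sphere 0 1 :: (real ^ 'n) set)" "sphere 0 1 \<noteq> ({} :: (real ^ 'n) set)"
    by auto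
  ultimately obtain x where x: "x \<in> sphere 0 1" and max: "\<And>y. y \<in> sphere 0 1 \<Longrightarrow> R y \<le> R x"
    by (metis continuous_attains_sup)
  have le: "R y \<le> R x" if "y \<noteq> 0" for y
  proof -
    have "R (inverse (norm y) *\<^sub>R y) = R y"
      using that assms by (simp add: R_def lp_norm_scaleR matrix_vector_mult_scaleR)
    with max[of "inverse (norm y) *\<^sub>R y"] that show ?thesis
      by simp
  qed
  have "x \<noteq> 0"
    using x by auto
  moreover have "pq_norm TYPE(real) p q A = ereal (R x)"
    unfolding pq_norm_def map_matrix_of_real_id using le \<open>x \<noteq> 0\<close>
    by (intro antisym SUP_least SUP_upper2[of x]) (auto simp: R_def)
  ultimately show ?thesis
    using that le unfolding R_def by blast
qed

section \<open>Sums and differences of pairs\<close>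

definition pairing_matrix :: "real ^ 3 ^ 6" where
  "pairing_matrix = vector [vector [1,  1,  0],
                            vector [1, -1,  0],
                            vector [0,  1,  1],
                            vector [0,  1, -1],
                            vector [1,  0,  1],
                            vector [1,  0, -1]]"

definition pair_sum :: "real \<Rightarrow> 'a::real_normed_vector \<Rightarrow> 'a \<Rightarrow> real" where
  "pair_sum q a b = norm (a + b) powr q + norm (a - b) powr q"

lemma pair_sum_nonneg: "pair_sum q a b \<ge> 0"
  by (simp add: pair_sum_def)

lemma sum_UNIV_6: "sum f (UNIV :: 6 set) = f 1 + f 2 + f 3 + f 4 + f 5 + f 6"
proof -
  have UNIV_eq: "(UNIV :: 6 set) = {1, 2, 3, 4, 5, 6}"
    by (rule sym, rule card_subset_eq) auto
  show ?thesis
    unfolding UNIV_eq by (simp add: add.assoc)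
qed

lemma lp_norm_pairing_matrix:
  fixes z :: "'f::real_normed_field ^ 3"
  shows "lp_norm (ereal q) (map_matrix of_real pairing_matrix *v z)
       = (pair_sum q (z $ 1) (z $ 2) + pair_sum q (z $ 2) (z $ 3)
          + pair_sum q (z $ 1) (z $ 3)) powr (1 / q)"
  by (simp add: lp_norm_ereal sum_UNIV_6 pairing_matrix_def map_matrix_def
      matrix_vector_mult_def sum_3 vector_6 vector_3 pair_sum_def add.assoc)

lemma lp_norm_pairing_matrix_real:
  fixes x :: "real ^ 3"
  shows "lp_norm (ereal q) (pairing_matrix *v x)
       = (pair_sum q (x $ 1) (x $ 2) + pair_sum q (x $ 2) (x $ 3)
          + pair_sum q (x $ 1) (x $ 3)) powr (1 / q)"
  using lp_norm_pairing_matrix[of q x] by (simp only: map_matrix_of_real_id)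

text \<open>
  Strict concavity: of two pairs of numbers with the same midpoint \<open>u\<close>, the wider one has the
  smaller sum of powers. The intervals from \<open>u + s\<close> to \<open>u + t\<close> and from \<open>u - t\<close> to
  \<open>u - s\<close> have the same length, and the derivative of the power is larger on the lower one. The
  mean value theorem still applies when \<open>u - t = 0\<close>, where the power is continuous but
  not differentiable; this case occurs below when two entries have the same absolute value.
\<close>
lemma powr_spread_less:
  fixes u s t r :: real
  assumes "0 < r" "r < 1" "\<bar>s\<bar> < t" "t \<le> u"
  shows "(u + t) powr r + (u - t) powr r < (u + s) powr r + (u - s) powr r"
proof -
  have main: "(u + t) powr r + (u - t) powr r < (u + s) powr r + (u - s) powr r"
    if st: "0 \<le> s" "s < t" for s
  proof -
    have cont: "continuous_on {a..b} (\<lambda>x. x powr r)" if "0 \<le> a" for a b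
      using that \<open>0 < r\<close> by (intro continuous_on_powr' continuous_intros) auto
    have deriv: "((\<lambda>x. x powr r) has_real_derivative r * x powr (r - 1)) (at x)" if "0 < x" for x
      using has_real_derivative_powr[OF that] .
    have mvt: "\<exists>x. a < x \<and> x < b \<and> b powr r - a powr r = (b - a) * (r * x powr (r - 1))"
      if "0 \<le> a" "a < b" for a b
    proof -
      have "(\<lambda>x. x powr r) differentiable at x" if "a < x" for x
        using deriv[of x] that \<open>0 \<le> a\<close> unfolding real_differentiable_def by fastforce
      then obtain l x where "a < x" "x < b" and D: "DERIV (\<lambda>x. x powr r) x :> l"
        and eq: "b powr r - a powr r = (b - a) * l"
        using MVT[OF \<open>a < b\<close> cont[OF \<open>0 \<le> a\<close>]] by blast
      moreover have "l = r * x powr (r - 1)"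
        using DERIV_unique[OF D deriv] that \<open>a < x\<close> by simp
      ultimately show ?thesis
        by blast
    qed
    obtain x where x: "u + s < x"
      and eqx: "(u + t) powr r - (u + s) powr r = (t - s) * (r * x powr (r - 1))"
      using mvt[of "u + s" "u + t"] st assms by auto
    obtain y where y: "u - t < y" "y < u - s"
      and eqy: "(u - s) powr r - (u - t) powr r = (t - s) * (r * y powr (r - 1))"
      using mvt[of "u - t" "u - s"] st assms by auto
    have "x powr (r - 1) < y powr (r - 1)"
      using x y st assms by (intro powr_less_mono2_neg) auto
    then have "(t - s) * (r * x powr (r - 1)) < (t - s) * (r * y powr (r - 1))"
      using st assms by simp
    with eqx eqy show ?thesis
      by linarith
  qed
  from main[of "\<bar>s\<bar>"] assms show ?thesis
    by (cases "s \<ge> 0") auto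
qed

text \<open>
  For fixed lengths of \<open>a\<close> and \<open>b\<close>, only the inner product depends on their directions, and up to
  sign it is half the distance of \<open>(norm (a + b))\<^sup>2\<close> and \<open>(norm (a - b))\<^sup>2\<close> from their midpoint.
\<close>
lemma pair_sum_powr_half:
  fixes a b :: "'a::real_inner"
  shows "pair_sum q a b
       = (((norm a)\<^sup>2 + (norm b)\<^sup>2) + 2 * (a \<bullet> b)) powr (q / 2)
       + (((norm a)\<^sup>2 + (norm b)\<^sup>2) - 2 * (a \<bullet> b)) powr (q / 2)"
proof -
  have half: "norm x powr q = ((norm x)\<^sup>2) powr (q / 2)" for x :: 'a
    by (cases "x = 0") (simp_all add: powr_powr flip: powr_numeral)
  show ?thesis
    unfolding pair_sum_def half[of "a + b"] half[of "a - b"]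
    by (simp add: power2_norm_eq_inner inner_add inner_diff inner_commute algebra_simps)
qed

text \<open>
  For real \<open>a\<close> and \<open>b\<close> the inner product has the largest possible absolute value \<open>\<bar>a * b\<bar>\<close>;
  unit factors that are not parallel shrink it, so \<open>powr_spread_less\<close> applies.
\<close>
lemma pair_sum_phase_less:
  fixes a b q :: real and u v :: complex
  assumes "0 < q" "q < 2" "norm u = 1" "norm v = 1" "\<bar>u \<bullet> v\<bar> < 1" "a \<noteq> 0" "b \<noteq> 0"
  shows "pair_sum q a b < pair_sum q (of_real a * u) (of_real b * v)"
proof -
  have inner: "(of_real a * u) \<bullet> (of_real b * v) = a * b * (u \<bullet> v)"
    by (simp add: inner_complex_def algebra_simps)
  have "\<bar>a * b * (u \<bullet> v)\<bar> < \<bar>a * b\<bar>"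
    using assms by (simp add: abs_mult)
  moreover have "2 * \<bar>a * b\<bar> \<le> a\<^sup>2 + b\<^sup>2"
    using sum_squares_bound[of "\<bar>a\<bar>" "\<bar>b\<bar>"] by (simp add: abs_mult)
  ultimately have "(a\<^sup>2 + b\<^sup>2 + 2 * \<bar>a * b\<bar>) powr (q / 2) + (a\<^sup>2 + b\<^sup>2 - 2 * \<bar>a * b\<bar>) powr (q / 2)
      < (a\<^sup>2 + b\<^sup>2 + 2 * (a * b * (u \<bullet> v))) powr (q / 2)
        + (a\<^sup>2 + b\<^sup>2 - 2 * (a * b * (u \<bullet> v))) powr (q / 2)"
    using assms by (intro powr_spread_less) auto
  then show ?thesis
    unfolding pair_sum_powr_half inner
    using assms by (cases "a * b \<ge> 0") (simp_all add: norm_mult)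
qed

lemma pair_sum_phase_le:
  fixes a b q :: real and u v :: complex
  assumes "0 < q" "q < 2" "norm u = 1" "norm v = 1" "\<bar>u \<bullet> v\<bar> < 1"
  shows "pair_sum q a b \<le> pair_sum q (of_real a * u) (of_real b * v)"
proof (cases "a = 0 \<or> b = 0")
  case True
  with assms show ?thesis
    by (auto simp: pair_sum_def norm_mult)
next
  case False
  with pair_sum_phase_less[of q u v a b] assms show ?thesis
    by simp
qed

section \<open>The maximum is not at a coordinate vector\<close>

lemma powr_one_plus_minus_ge:
  fixes e q :: real
  assumes "1 \<le> q" "\<bar>e\<bar> < 1"
  shows "(1 + e) powr q + (1 - e) powr q \<ge> 2"
proof -
  have "((1 - 1 / 2) *\<^sub>R (1 + e) + (1 / 2) *\<^sub>R (1 - e)) powr q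
      \<le> (1 - 1 / 2) * (1 + e) powr q + (1 / 2) * (1 - e) powr q"
    using assms by (intro convex_onD[OF powr_convex]) auto
  then show ?thesis
    by (simp add: field_simps)
qed

lemma lp_norm_axis:
  fixes a :: "'a::real_normed_vector"
  assumes "p > 0"
  shows "lp_norm p (axis i a :: 'a ^ 'n) = norm a"
proof (cases p)
  case (real r)
  have "(\<Sum>t\<in>UNIV. norm ((axis i a :: 'a ^ 'n) $ t) powr r)
      = (\<Sum>t\<in>UNIV. if t = i then norm a powr r else 0)"
    by (intro sum.cong) (auto simp: axis_def)
  with assms real show ?thesis
    by (simp add: lp_norm_ereal powr_powr)
next
  case PInf
  have "Max (range (\<lambda>t. norm ((axis i a :: 'a ^ 'n) $ t))) = norm a"
    by (intro Max_eqI) (auto simp: axis_def intro!: image_eqI[of _ _ i])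
  with PInf show ?thesis
    by (simp add: lp_norm_def)
next
  case MInf
  with assms show ?thesis by simp
qed

lemma one_entry_ratio:
  fixes c :: real
  assumes "0 < q" "0 < p" "c \<noteq> 0"
  shows "lp_norm (ereal q) (pairing_matrix *v axis i c) / lp_norm p (axis i c) = 4 powr (1 / q)"
proof -
  have "i \<in> {1, 2, 3}"
    by (metis UNIV_3 UNIV_I)
  then have "lp_norm (ereal q) (pairing_matrix *v axis i c) = (4 * \<bar>c\<bar> powr q) powr (1 / q)"
    unfolding lp_norm_pairing_matrix_real
    by (auto simp: pair_sum_def axis_def)
  then show ?thesis
    using assms by (simp add: lp_norm_axis powr_mult powr_powr)
qed

text \<open>
  By \<open>one_entry_ratio\<close>, \<open>4 powr (1 / q)\<close> is the quotient at every coordinate vector. The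
  competitor is \<open>(1, e, 0)\<close>: by convexity its pairs give at least \<open>4 + 2 * e powr q\<close>, while \<open>e\<close> is
  chosen such that the \<open>q\<close>-th power of its \<open>p\<close>-norm is at most \<open>1 + e powr q / 3\<close>. Any
  factor below \<open>1 / 2\<close> would do in place of \<open>1 / 3\<close>.
\<close>
lemma two_entries_beat_one:
  fixes q :: real
  assumes "1 \<le> q" "ereal q < p"
  obtains y :: "real ^ 3" where "y \<noteq> 0"
    and "4 powr (1 / q) < lp_norm (ereal q) (pairing_matrix *v y) / lp_norm p y"
proof -
  define y :: "real \<Rightarrow> real ^ 3" where "y = (\<lambda>e. vector [1, e, 0])"
  obtain e where e: "0 < e" "e < 1" and p_norm: "lp_norm p (y e) \<le> (1 + e powr q / 3) powr (1 / q)"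
  proof (cases p)
    case (real s)
    with assms have s: "q < s"
      by simp
    \<comment> \<open>the solution of \<open>e powr (s - q) = 1 / 3\<close>\<close>
    define e :: real where "e = (1 / 3) powr (1 / (s - q))"
    have e: "0 < e" "e < 1"
      using s powr_less_mono2[of "1 / (s - q)" "1 / 3" 1] unfolding e_def by simp_all
    have "e powr s = e powr q * e powr (s - q)"
      by (simp flip: powr_add)
    also have "e powr (s - q) = 1 / 3"
      using s by (simp add: e_def powr_powr)
    finally have es: "e powr s = e powr q / 3"
      by simp
    have "lp_norm p (y e) = (1 + e powr q / 3) powr (1 / s)"
      unfolding es[symmetric] using real e by (simp add: lp_norm_ereal sum_3 y_def vector_3)
    also have "\<dots> \<le> (1 + e powr q / 3) powr (1 / q)"
      using s assms by (intro powr_mono) (auto simp: frac_le)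
    finally show ?thesis
      using that e by blast
  next
    case PInf
    have "lp_norm p (y (1 / 2)) = 1"
      using PInf by (simp add: lp_norm_def y_def UNIV_3 vector_3)
    also have "1 \<le> (1 + (1 / 2) powr q / 3) powr (1 / q)"
      using assms by (intro ge_one_powr_ge_zero) auto
    finally show ?thesis
      using that[of "1 / 2"] by simp
  next
    case MInf
    with assms show ?thesis by simp
  qed
  have "y e $ 1 = 1"
    by (simp add: y_def vector_3)
  then have nz: "y e \<noteq> 0"
    by auto
  have "4 powr (1 / q) * lp_norm p (y e) \<le> 4 powr (1 / q) * (1 + e powr q / 3) powr (1 / q)"
    using p_norm by simp
  also have "\<dots> = (4 + 4 / 3 * e powr q) powr (1 / q)"
    by (simp add: powr_mult[symmetric] algebra_simps)
  also have "\<dots> < (4 + 2 * e powr q) powr (1 / q)"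
    using e assms by (intro powr_less_mono2) (auto intro: add_pos_nonneg)
  also have "\<dots> \<le> ((1 + e) powr q + (1 - e) powr q + 2 * e powr q + 2) powr (1 / q)"
    using powr_one_plus_minus_ge[of q e] e assms by (intro powr_mono2) auto
  also have "\<dots> = lp_norm (ereal q) (pairing_matrix *v y e)"
    using e unfolding lp_norm_pairing_matrix_real
    by (simp add: y_def vector_3 pair_sum_def algebra_simps)
  finally show ?thesis
    using that[OF nz] lp_norm_pos[OF nz, of p] by (simp add: pos_less_divide_eq)
qed

section \<open>Complex phases at a real maximiser\<close>

theorem proposition4p1:
  fixes p q :: ereal and A :: "real ^ 3 ^ 6"
  assumes "1 \<le> q" and "q < 2" and "q < p" and "p \<le> \<infinity>"
    and "A = vector [vector [1,  1,  0],
                     vector [1, -1,  0],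
                     vector [0,  1,  1],
                     vector [0,  1, -1],
                     vector [1,  0,  1],
                     vector [1,  0, -1]]"
  shows "pq_norm TYPE(complex) p q A > pq_norm TYPE(real) p q A"
proof -
  obtain r where q: "q = ereal r" and r: "1 \<le> r" "r < 2"
    using assms by (cases q) auto
  have pos: "0 < q" "0 < p"
    using assms(3) r by (auto simp: q elim!: less_trans[rotated])
  have A: "A = pairing_matrix"
    using assms by (simp add: pairing_matrix_def)
  obtain x :: "real ^ 3" where x: "x \<noteq> 0"
    and attained: "pq_norm TYPE(real) p q A = ereal (lp_norm q (A *v x) / lp_norm p x)"
    and max: "\<And>y. y \<noteq> 0 \<Longrightarrow> lp_norm q (A *v y) / lp_norm p y \<le> lp_norm q (A *v x) / lp_norm p x"
    using real_pq_norm_attained[OF pos(2,1)] by metis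
  have "x \<noteq> axis i c" for i c
  proof
    assume eq: "x = axis i c"
    with x have "c \<noteq> 0"
      by auto
    with eq have "lp_norm q (A *v x) / lp_norm p x = 4 powr (1 / r)"
      using one_entry_ratio[of r p c i] pos r by (simp add: A q)
    moreover obtain y :: "real ^ 3" where "y \<noteq> 0" "4 powr (1 / r) < lp_norm q (A *v y) / lp_norm p y"
      using two_entries_beat_one[of r p] r assms(3) unfolding A q by metis
    ultimately show False
      using max[of y] by simp
  qed
  from this[of 1 "x $ 1"] this[of 2 "x $ 2"] this[of 3 "x $ 3"]
  have two: "x $ 1 \<noteq> 0 \<and> x $ 2 \<noteq> 0 \<or> x $ 2 \<noteq> 0 \<and> x $ 3 \<noteq> 0 \<or> x $ 1 \<noteq> 0 \<and> x $ 3 \<noteq> 0"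
    by (auto simp: vec_eq_iff forall_3 axis_def)
  \<comment> \<open>three unit numbers, no two of them parallel: the pairwise inner products are 0, 4/5 and 3/5\<close>
  define w :: "complex ^ 3" where "w = vector [1, \<i>, Complex (3 / 5) (4 / 5)]"
  define z :: "complex ^ 3" where "z = (\<chi> t. of_real (x $ t) * w $ t)"
  have w: "norm (w $ t) = 1" for t
    using exhaust_3[of t] by (auto simp: w_def vector_3 complex_norm power2_eq_square)
  have inner: "\<bar>w $ 1 \<bullet> w $ 2\<bar> < 1" "\<bar>w $ 2 \<bullet> w $ 3\<bar> < 1" "\<bar>w $ 1 \<bullet> w $ 3\<bar> < 1"
    by (simp_all add: w_def vector_3 inner_complex_def)
  have z_norm: "lp_norm p z = lp_norm p x"
    unfolding lp_norm_def by (simp add: z_def norm_mult w)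
  have z: "z \<noteq> 0"
  proof
    assume "z = 0"
    then have "norm (z $ t) = 0" for t
      by simp
    then have "x = 0"
      by (simp add: z_def norm_mult w vec_eq_iff)
    with x show False ..
  qed
  have le: "pair_sum r (x $ i) (x $ j) \<le> pair_sum r (z $ i) (z $ j)"
    and less: "x $ i \<noteq> 0 \<and> x $ j \<noteq> 0 \<Longrightarrow> pair_sum r (x $ i) (x $ j) < pair_sum r (z $ i) (z $ j)"
    if "\<bar>w $ i \<bullet> w $ j\<bar> < 1" for i j
    using that r w pair_sum_phase_le pair_sum_phase_less by (auto simp: z_def)
  have "pair_sum r (x $ 1) (x $ 2) + pair_sum r (x $ 2) (x $ 3) + pair_sum r (x $ 1) (x $ 3)
      < pair_sum r (z $ 1) (z $ 2) + pair_sum r (z $ 2) (z $ 3) + pair_sum r (z $ 1) (z $ 3)"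
    using two less[OF inner(1)] less[OF inner(2)] less[OF inner(3)]
      le[OF inner(1)] le[OF inner(2)] le[OF inner(3)]
    by (elim disjE) simp_all
  then have "lp_norm q (A *v x) < lp_norm q (map_matrix of_real A *v z)"
    unfolding A q lp_norm_pairing_matrix lp_norm_pairing_matrix_real
    using r by (intro powr_less_mono2) (auto simp: pair_sum_nonneg)
  then have "lp_norm q (A *v x) / lp_norm p x < lp_norm q (map_matrix of_real A *v z) / lp_norm p z"
    using lp_norm_pos[OF x] by (simp add: z_norm divide_strict_right_mono)
  also have "ereal \<dots> \<le> pq_norm TYPE(complex) p q A"
    unfolding pq_norm_def using z by (intro SUP_upper) auto
  finally show ?thesis
    using attained by simp
qed

end
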